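(* Let $G$ be a finite connected graph of diameter $D(G) \geq 6$. Then $c(G) \leq \gamma(G)-1$, where $c(G)$ is the cop number of $G$ and $\gamma(G)$ is the domination number of $G$.
   Context: The game of Cops and Robbers on a finite undirected graph $G$: one player controls $k$ cops and the other a single robber. First the cops choose starting vertices (several cops may share a vertex), then the robber chooses a starting vertex. Players then alternate turns, beginning with the cops; on the cops' turn each cop moves to a vertex at distance at most $1$ from its current vertex, and on the robber's turn the robber does likewise. The cops win if at some point the robber occupies the same vertex as some cop; otherwise the robber wins. The cop number $c(G)$ is the minimum $k$ such that $k$ cops have a winning strategy. The domination number $\gamma(G)$ is the minimum size of a set $S \subseteq V(G)$ such that every vertex not in $S$ has a neighbour in $S$. $D(G)$ is the diameter of $G$. *)

theory Defs
  imports "Graph_Theory.Digraph_Component" "Graph_Theory.Shortest_Path"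
begin

definition graph_dist :: "('a, 'b) pre_digraph \<Rightarrow> 'a \<Rightarrow> 'a \<Rightarrow> ereal" where
  "graph_dist G u v = wf_digraph.\<mu> G (\<lambda>_. 1) u v"

definition diameter :: "('a, 'b) pre_digraph \<Rightarrow> ereal" where
  "diameter G = (SUP u\<in>verts G. SUP v\<in>verts G. graph_dist G u v)"

definition dominating_set :: "('a, 'b) pre_digraph \<Rightarrow> 'a set \<Rightarrow> bool" where
  "dominating_set G S \<longleftrightarrow>
     S \<subseteq> verts G \<and> (\<forall>v\<in>verts G - S. \<exists>u\<in>S. v \<rightarrow>\<^bsub>G\<^esub> u)"

definition domination_number :: "('a, 'b) pre_digraph \<Rightarrow> nat" where
  "domination_number G = (LEAST n. \<exists>S. dominating_set G S \<and> card S = n)"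

definition legal_move :: "('a, 'b) pre_digraph \<Rightarrow> 'a \<Rightarrow> 'a \<Rightarrow> bool" where
  "legal_move G u v \<longleftrightarrow> u \<in> verts G \<and> v \<in> verts G \<and> graph_dist G u v \<le> 1"

text \<open>
  A trajectory \<^term>\<open>r\<close> lists the robber's positions: \<^term>\<open>r 0\<close> is the starting vertex and
  \<^term>\<open>r (Suc n)\<close> the vertex occupied after the robber's turn number \<^term>\<open>Suc n\<close>.
\<close>
definition robber_trajectory :: "('a, 'b) pre_digraph \<Rightarrow> (nat \<Rightarrow> 'a) \<Rightarrow> bool" where
  "robber_trajectory G r \<longleftrightarrow> r 0 \<in> verts G \<and> (\<forall>n. legal_move G (r n) (r (Suc n)))"

text \<open>
  A strategy of the cops maps the list of all robber positions seen so far to the cops' next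
  positions, entry \<^term>\<open>i\<close> being the vertex of cop number \<^term>\<open>i\<close>. On the empty list it yields
  the starting positions, which are chosen before the robber appears. The cops' own past
  positions need not be an argument, as they are determined by the strategy.
\<close>
type_synonym 'a cop_strategy = "'a list \<Rightarrow> 'a list"

definition cop_positions :: "'a cop_strategy \<Rightarrow> (nat \<Rightarrow> 'a) \<Rightarrow> nat \<Rightarrow> 'a list" where
  "cop_positions \<sigma> r n = \<sigma> (map r [0..<n])"

definition legal_cop_strategy :: "('a, 'b) pre_digraph \<Rightarrow> nat \<Rightarrow> 'a cop_strategy \<Rightarrow> bool" where
  "legal_cop_strategy G k \<sigma> \<longleftrightarrow>
     length (\<sigma> []) = k \<and> set (\<sigma> []) \<subseteq> verts G \<and>
     (\<forall>r. robber_trajectory G r \<longrightarrow>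
        (\<forall>n. list_all2 (legal_move G) (cop_positions \<sigma> r n) (cop_positions \<sigma> r (Suc n))))"

text \<open>
  The cops at \<^term>\<open>cop_positions \<sigma> r n\<close> face the robber at \<^term>\<open>r n\<close> after a robber turn (or
  after the initial placement); the cops then move to \<^term>\<open>cop_positions \<sigma> r (Suc n)\<close> while
  the robber is still at \<^term>\<open>r n\<close>. Plays are continued formally after a capture, which does
  not affect who wins. A fixed strategy wins if it beats every trajectory, since a
  robber reacting to the cops' moves also produces some trajectory.
\<close>
definition robber_caught :: "'a cop_strategy \<Rightarrow> (nat \<Rightarrow> 'a) \<Rightarrow> bool" where
  "robber_caught \<sigma> r \<longleftrightarrow>
     (\<exists>n. r n \<in> set (cop_positions \<sigma> r n) \<or> r n \<in> set (cop_positions \<sigma> r (Suc n)))"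

definition cops_win :: "('a, 'b) pre_digraph \<Rightarrow> nat \<Rightarrow> bool" where
  "cops_win G k \<longleftrightarrow>
     (\<exists>\<sigma>. legal_cop_strategy G k \<sigma> \<and> (\<forall>r. robber_trajectory G r \<longrightarrow> robber_caught \<sigma> r))"

definition cop_number :: "('a, 'b) pre_digraph \<Rightarrow> nat" where
  "cop_number G = (LEAST k. cops_win G k)"

lemma legal_move_iff:
  assumes "wf_digraph G"
  shows "legal_move G u v \<longleftrightarrow> u \<in> verts G \<and> v \<in> verts G \<and> (u = v \<or> u \<rightarrow>\<^bsub>G\<^esub> v)"
proof -
  interpret wf_digraph G by fact
  have cost: "awalk_cost (\<lambda>_. 1) p = real (length p)" for p :: "'b list"
    by (induct p) auto
  have "u = v \<or> u \<rightarrow>\<^bsub>G\<^esub> v" if le: "graph_dist G u v \<le> 1"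
  proof -
    have "\<exists>p. awalk u p v \<and> length p < 2"
    proof (rule ccontr)
      assume "\<nexists>p. awalk u p v \<and> length p < 2"
      then have "(2::ereal) \<le> graph_dist G u v"
        unfolding graph_dist_def \<mu>_def cost
        by (intro INF_greatest) (auto simp: not_less)
      from order_trans[OF this le] have "(2::ereal) \<le> 1" .
      then show False by simp
    qed
    then obtain p where p: "awalk u p v" "length p < 2" by blast
    then show ?thesis
      by (cases p) (auto simp: awalk_Cons_iff awalk_Nil_iff arcs_ends_conv)
  qed
  moreover have "graph_dist G u v \<le> 1" if "u \<in> verts G" "u = v \<or> u \<rightarrow>\<^bsub>G\<^esub> v"
  proof -
    have "\<exists>p. awalk u p v \<and> length p \<le> 1"
    proof (cases "u = v")
      case True
      with that show ?thesis by (intro exI[of _ "[]"]) (simp add: awalk_Nil_iff)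
    next
      case False
      with that obtain e where "e \<in> arcs G" "tail G e = u" "head G e = v"
        by (auto simp: arcs_ends_conv)
      then show ?thesis
        by (intro exI[of _ "[e]"]) (auto simp: awalk_Cons_iff awalk_Nil_iff)
    qed
    then obtain p where p: "awalk u p v" "length p \<le> 1" by blast
    have "graph_dist G u v \<le> ereal (real (length p))"
      using min_cost_le_walk_cost[OF p(1), of "\<lambda>_. 1"] by (simp add: graph_dist_def cost)
    also have "\<dots> \<le> 1" using p(2) by simp
    finally show ?thesis .
  qed
  ultimately show ?thesis unfolding legal_move_def by blast
qed

end

theory Submission
  imports Defs
begin

text \<open>
  Let \<open>S\<close> be a minimum dominating set and let \<open>u\<close>, \<open>v\<close> be vertices at distance at least 6. Any
  \<open>s, t \<in> S\<close> dominating \<open>u\<close> and \<open>v\<close> are at distance at least 4, so no edge joins the closed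
  neighbourhoods \<open>N[s]\<close> and \<open>N[t]\<close>. Place one cop on each vertex of \<open>S - {s}\<close>. The robber must
  start in \<open>N[s]\<close>, and while the cops of \<open>S - {s, t}\<close> stand still he can leave \<open>N[s]\<close> only by
  stepping next to one of them, as \<open>N[t]\<close> is not within one step. Hence the cop on \<open>t\<close> is free
  to walk to \<open>s\<close>, from where he catches the robber.
\<close>

text \<open>Choosing at every vertex a successor nearer to \<open>s\<close> makes the distance drop
  to 0. One function serves all starting points, so a cop's walk to \<open>s\<close> is mere
  iteration.\<close>

lemma ex_successor_funpow_reaching:
  assumes "R s s"
  obtains f where "\<And>v. R\<^sup>*\<^sup>* v s \<Longrightarrow> R v (f v)"
    and "\<And>v. R\<^sup>*\<^sup>* v s \<Longrightarrow> \<exists>n. (f ^^ n) v = s"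
proof -
  define d where "d v = (LEAST n. (R ^^ n) v s)" for v
  \<comment> \<open>\<open>d v\<close> is the length of a shortest chain from \<open>v\<close> to
    \<open>s\<close>, where one exists. On reaching \<open>s\<close> the walk rests there, which
    \<open>R s s\<close> permits.\<close>
  define f where "f v = (if v = s then s else SOME u. R v u \<and> R\<^sup>*\<^sup>* u s \<and> d u < d v)" for v
  have f: "R v (f v) \<and> R\<^sup>*\<^sup>* (f v) s \<and> d (f v) < d v" if "R\<^sup>*\<^sup>* v s" "v \<noteq> s" for v
  proof -
    from that(1) have "\<exists>n. (R ^^ n) v s" by (simp add: rtranclp_power)
    then have dv: "(R ^^ d v) v s" unfolding d_def by (rule LeastI_ex)
    with \<open>v \<noteq> s\<close> obtain m where m: "d v = Suc m" by (cases "d v") auto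
    with dv obtain u where u: "R v u" "(R ^^ m) u s" by (metis relpowp_Suc_D2)
    have "d u \<le> m" unfolding d_def using u(2) by (rule Least_le)
    with u m have "R v u \<and> R\<^sup>*\<^sup>* u s \<and> d u < d v" by (auto simp: rtranclp_power)
    then have "R v (SOME u. R v u \<and> R\<^sup>*\<^sup>* u s \<and> d u < d v) \<and>
        R\<^sup>*\<^sup>* (SOME u. R v u \<and> R\<^sup>*\<^sup>* u s \<and> d u < d v) s \<and>
        d (SOME u. R v u \<and> R\<^sup>*\<^sup>* u s \<and> d u < d v) < d v" by (rule someI)
    with \<open>v \<noteq> s\<close> show ?thesis by (simp add: f_def)
  qed
  show ?thesis
  proof
    show "R v (f v)" if "R\<^sup>*\<^sup>* v s" for v
      using f[OF that] assms by (cases "v = s") (auto simp: f_def)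
    show "\<exists>n. (f ^^ n) v = s" if "R\<^sup>*\<^sup>* v s" for v
      using that
    proof (induction "d v" arbitrary: v rule: less_induct)
      case less
      show ?case
      proof (cases "v = s")
        case True
        then show ?thesis by (intro exI[of _ 0]) simp
      next
        case False
        with f[of v] less obtain n where "(f ^^ n) (f v) = s" by blast
        then show ?thesis by (intro exI[of _ "Suc n"]) (simp add: funpow_swap1)
      qed
    qed
  qed
qed

lemma (in graph) legal_move_sym: "legal_move G x y \<Longrightarrow> legal_move G y x"
  using arcs_ends_symmetric[OF sym_arcs] by (auto simp: legal_move_iff[OF wf_digraph_axioms])

text \<open>Each move contributes one arc, or none when it stands still; this turns lower bounds on
  distance into the absence of short chains of moves.\<close>

lemma (in graph) graph_dist_le_relpowp_legal_move:
  assumes "(legal_move G ^^ n) x y" "x \<in> verts G"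
  shows "graph_dist G x y \<le> ereal (real n)"
proof -
  have cost: "awalk_cost (\<lambda>_. 1) p = real (length p)" for p :: "'b list"
    by (induct p) auto
  have "\<exists>p. awalk x p y \<and> length p \<le> n"
    using assms(1)
  proof (induction n arbitrary: y)
    case 0
    with assms(2) show ?case by (auto simp: awalk_Nil_iff)
  next
    case (Suc n)
    then obtain z where z: "(legal_move G ^^ n) x z" "legal_move G z y" by auto
    with Suc.IH obtain p where p: "awalk x p z" "length p \<le> n" by blast
    from z(2) consider "z = y" | e where "e \<in> arcs G" "tail G e = z" "head G e = y"
      by (auto simp: legal_move_iff[OF wf_digraph_axioms] arcs_ends_conv)
    then show ?case
    proof cases
      case 1
      with p show ?thesis by (intro exI[of _ p]) auto
    next
      case 2
      then have "awalk z [e] y" by (auto simp: awalk_Cons_iff awalk_Nil_iff)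
      with p(1) have "awalk x (p @ [e]) y" by (rule awalk_appendI)
      with p(2) show ?thesis by (intro exI[of _ "p @ [e]"]) auto
    qed
  qed
  then obtain p where p: "awalk x p y" "length p \<le> n" by blast
  have "graph_dist G x y \<le> ereal (real (length p))"
    using min_cost_le_walk_cost[OF p(1), of "\<lambda>_. 1"] by (simp add: graph_dist_def cost)
  also have "\<dots> \<le> ereal (real n)" using p(2) by simp
  finally show ?thesis .
qed

lemma (in graph) rtranclp_legal_move:
  assumes "connected G" "x \<in> verts G" "y \<in> verts G"
  shows "(legal_move G)\<^sup>*\<^sup>* x y"
proof -
  have "x \<rightarrow>\<^sup>* y"
    using symmetric_connected_imp_strongly_connected[OF sym_arcs assms(1)] assms(2,3)
    by (auto simp: strongly_connected_def)
  then show ?thesis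
  proof (induction rule: reachable_induct)
    case base
    show ?case by simp
  next
    case (step a b)
    have "legal_move G a b"
      using step.hyps by (auto simp: legal_move_iff[OF wf_digraph_axioms] adj_in_verts)
    with step.IH show ?case by simp
  qed
qed

lemma (in graph) dominating_setD:
  assumes "dominating_set G S" "x \<in> verts G"
  obtains c where "c \<in> S" "legal_move G x c"
proof (cases "x \<in> S")
  case True
  with assms show ?thesis by (intro that[of x]) (auto simp: legal_move_iff[OF wf_digraph_axioms])
next
  case False
  with assms obtain c where "c \<in> S" "x \<rightarrow> c" by (auto simp: dominating_set_def)
  with assms show ?thesis
    by (intro that[of c]) (auto simp: legal_move_iff[OF wf_digraph_axioms] dominating_set_def)
qed

text \<open>One turn of a cop: capture if possible, otherwise follow the plan \<open>f\<close>.
  Folding it over the robber's past positions recovers the cop's position, as a strategy sees only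
  that history.\<close>

definition chase_step :: "('a, 'b) pre_digraph \<Rightarrow> ('a \<Rightarrow> 'a) \<Rightarrow> 'a \<Rightarrow> 'a \<Rightarrow> 'a" where
  "chase_step G f c x = (if legal_move G c x then x else f c)"

lemma foldl_chase_step_in_verts:
  assumes "\<And>v. v \<in> verts G \<Longrightarrow> legal_move G v (f v)" "c \<in> verts G"
  shows "foldl (chase_step G f) c xs \<in> verts G"
  using assms
  by (induction xs rule: rev_induct) (simp_all add: chase_step_def legal_move_def)

text \<open>While the robber stays out of reach, the capturing branch is never taken, so the
  position depends on the plan alone.\<close>

lemma foldl_chase_step_eq_funpow:
  assumes "\<And>m. m < n \<Longrightarrow> \<not> legal_move G (foldl (chase_step G f) c (map r [0..<m])) (r m)"
  shows "foldl (chase_step G f) c (map r [0..<n]) = (f ^^ n) c"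
  using assms
proof (induction n)
  case (Suc n)
  have "foldl (chase_step G f) c (map r [0..<n]) = (f ^^ n) c"
    using Suc.prems by (intro Suc.IH) simp
  with Suc.prems[of n] show ?case by (simp add: chase_step_def[of _ _ "(f ^^ n) c"])
qed simp

theorem (in graph) cops_win_card_dominating_set_diff_1:
  assumes con: "connected G" and dom: "dominating_set G S"
    and s: "s \<in> S" and t: "t \<in> S"
    and far: "\<not> (legal_move G ^^ 3) s t"
  shows "cops_win G (card S - 1)"
proof -
  have SV: "S \<subseteq> verts G" using dom by (simp add: dominating_set_def)
  have refl: "legal_move G x x" if "x \<in> verts G" for x
    using that by (simp add: legal_move_iff[OF wf_digraph_axioms])
  \<comment> \<open>Waiting at \<open>s\<close> for three turns is itself a chain of three moves.
    Distinctness gives \<open>rest\<close> exactly \<open>card S - 2\<close> members.\<close>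
  have "s \<noteq> t"
  proof
    assume "s = t"
    have "(legal_move G ^^ 3) s s"
      using refl[of s] s SV by (auto simp: numeral_3_eq_3)
    with far \<open>s = t\<close> show False by simp
  qed
  have finS: "finite S" using SV by (rule finite_subset) simp
  obtain rest where rest: "set rest = S - {s, t}" "distinct rest"
    using finite_distinct_list[of "S - {s, t}"] finS by auto
  obtain f where f: "\<And>v. v \<in> verts G \<Longrightarrow> legal_move G v (f v)"
    and reach: "\<exists>n. (f ^^ n) t = s"
    using ex_successor_funpow_reaching[of "legal_move G" s] refl[of s] s t SV
      rtranclp_legal_move[OF con] by (metis subsetD)
  let ?walk = "foldl (chase_step G f)" and ?stay = "foldl (chase_step G id)"
  \<comment> \<open>One cop walks from \<open>t\<close> to \<open>s\<close>, and one guard waits on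
    each vertex of \<open>rest\<close> with plan \<open>id\<close>; no cop is placed for
    \<open>s\<close>.\<close>
  define \<sigma> where "\<sigma> xs = ?walk t xs # map (\<lambda>c. ?stay c xs) rest" for xs
  have legal_step: "legal_move G c (chase_step G g c x)"
    if "\<And>v. v \<in> verts G \<Longrightarrow> legal_move G v (g v)" "c \<in> verts G" for g c x
    using that by (simp add: chase_step_def)
  have "card S = card (set rest) + 2"
    using card_Diff_subset[of "{s, t}" S] card_mono[of S "{s, t}"] finS s t \<open>s \<noteq> t\<close> rest by simp
  then have len: "length (\<sigma> []) = card S - 1"
    using distinct_card[OF rest(2)] by (simp add: \<sigma>_def)
  have "legal_cop_strategy G (card S - 1) \<sigma>"
    unfolding legal_cop_strategy_def
  proof (intro conjI allI impI)
    show "length (\<sigma> []) = card S - 1" by (fact len)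
    show "set (\<sigma> []) \<subseteq> verts G" using rest SV t by (auto simp: \<sigma>_def)
    fix r :: "nat \<Rightarrow> 'a" and n
    have "legal_move G (?walk t xs) (chase_step G f (?walk t xs) x)" for xs x
      using t SV by (intro legal_step foldl_chase_step_in_verts f) auto
    moreover have "legal_move G (?stay c xs) (chase_step G id (?stay c xs) x)"
      if "c \<in> set rest" for c xs x
      using that rest SV refl by (intro legal_step foldl_chase_step_in_verts) auto
    ultimately show "list_all2 (legal_move G) (cop_positions \<sigma> r n) (cop_positions \<sigma> r (Suc n))"
      by (auto simp: cop_positions_def \<sigma>_def list.rel_map intro: list.rel_refl_strong)
  qed
  moreover have "robber_caught \<sigma> r" if r: "robber_trajectory G r" for r
  proof (rule ccontr)
    assume free: "\<not> robber_caught \<sigma> r"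
    have rV: "r n \<in> verts G" and rmove: "legal_move G (r n) (r (Suc n))" for n
      using r by (auto simp: robber_trajectory_def legal_move_def)
    have uncaught: "r n \<notin> set (\<sigma> (map r [0..<n] @ [r n]))" for n
      using free by (simp add: robber_caught_def cop_positions_def)
    \<comment> \<open>A cop with the robber in reach would step onto him in this very turn.\<close>
    have not_walk: "\<not> legal_move G (?walk t (map r [0..<n])) (r n)" for n
      using uncaught[of n] by (auto simp: \<sigma>_def chase_step_def)
    have not_stay: "\<not> legal_move G (?stay c (map r [0..<n])) (r n)" if "c \<in> set rest" for c n
    proof
      assume "legal_move G (?stay c (map r [0..<n])) (r n)"
      then have "?stay c (map r [0..<n] @ [r n]) = r n" by (simp add: chase_step_def)
      with that have "r n \<in> set (\<sigma> (map r [0..<n] @ [r n]))"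
        unfolding \<sigma>_def by (metis (no_types, lifting) image_eqI list.set_intros(2) list.set_map)
      with uncaught show False by blast
    qed
    \<comment> \<open>A guard who never had the robber in reach has only followed \<open>id\<close>,
      and so still stands on \<open>c\<close>.\<close>
    have not_rest: "\<not> legal_move G c (r n)" if "c \<in> set rest" for c n
      using not_stay[OF that, of n] foldl_chase_step_eq_funpow[of n G id c r] not_stay[OF that] by simp
    have not_walk': "\<not> legal_move G ((f ^^ n) t) (r n)" for n
      using not_walk[of n] foldl_chase_step_eq_funpow[of n G f t r] not_walk by simp
    have dom_r: "legal_move G s (r n) \<or> legal_move G t (r n)" for n
    proof -
      obtain c where "c \<in> S" "legal_move G (r n) c" using dominating_setD[OF dom rV] .
      with not_rest[of c n] rest(1) legal_move_sym show ?thesis by blast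
    qed
    have confined: "legal_move G s (r n)" for n
    proof (induction n)
      case 0
      \<comment> \<open>At time 0 the walking cop is still on \<open>t\<close>, which keeps the
        robber from starting next to \<open>t\<close>.\<close>
      show ?case using dom_r[of 0] not_walk'[of 0] by simp
    next
      case (Suc n)
      have "\<not> legal_move G t (r (Suc n))"
      proof
        assume "legal_move G t (r (Suc n))"
        then have "legal_move G (r (Suc n)) t" by (rule legal_move_sym)
        \<comment> \<open>The three moves: \<open>s\<close> to \<open>r n\<close> by induction, the
          robber's own move, and \<open>r (Suc n)\<close> to \<open>t\<close>.\<close>
        with Suc rmove[of n] have "(legal_move G ^^ 3) s t"
          by (auto simp: numeral_3_eq_3)
        with far show False ..
      qed
      with dom_r show ?case by blast
    qed
    \<comment> \<open>When the walking cop stands on \<open>s\<close>, the confined robber is within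
      reach.\<close>
    from reach obtain n where "(f ^^ n) t = s" by blast
    with not_walk'[of n] confined[of n] show False by simp
  qed
  ultimately show ?thesis by (auto simp: cops_win_def)
qed

text \<open>Over a finite nonempty vertex set both suprema are maxima, so the bound on the diameter
  yields an actual pair of vertices.\<close>

lemma (in graph) diameter_attained:
  assumes "verts G \<noteq> {}"
  obtains u v where "u \<in> verts G" "v \<in> verts G" "graph_dist G u v = diameter G"
proof -
  have attained: "\<exists>x\<in>verts G. h x = (SUP x\<in>verts G. h x)" for h :: "'a \<Rightarrow> ereal"
    using Max_in[of "h ` verts G"] assms by (auto simp: Max_Sup)
  obtain u where u: "u \<in> verts G" "(SUP v\<in>verts G. graph_dist G u v) = diameter G"
    using attained[of "\<lambda>u. SUP v\<in>verts G. graph_dist G u v"] by (auto simp: diameter_def)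
  moreover obtain v where "v \<in> verts G" "graph_dist G u v = (SUP v\<in>verts G. graph_dist G u v)"
    using attained by blast
  ultimately show ?thesis using that by simp
qed

theorem theorem2:
  fixes G :: "('a, 'b) pre_digraph"
  assumes "graph G"
    and "Digraph_Component.connected G"
    and "diameter G \<ge> 6"
  shows "int (cop_number G) \<le> int (domination_number G) - 1"
proof -
  interpret graph G by fact
  have "\<exists>n S. dominating_set G S \<and> card S = n"
    by (intro exI[of _ "verts G"] exI) (auto simp: dominating_set_def)
  then have "\<exists>S. dominating_set G S \<and> card S = domination_number G"
    unfolding domination_number_def by (rule LeastI_ex)
  then obtain S where dom: "dominating_set G S" and card: "card S = domination_number G"
    by blast
  have ne: "verts G \<noteq> {}"
    using symmetric_connected_imp_strongly_connected[OF sym_arcs assms(2)]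
    by (simp add: strongly_connected_def)
  obtain u v where u: "u \<in> verts G" and v: "v \<in> verts G" and uv: "graph_dist G u v \<ge> 6"
    using diameter_attained[OF ne] assms(3) by metis
  obtain s where s: "s \<in> S" "legal_move G u s" using dominating_setD[OF dom u] .
  obtain t where t: "t \<in> S" "legal_move G v t" using dominating_setD[OF dom v] .
  \<comment> \<open>Adding the moves from \<open>u\<close> to \<open>s\<close> and from
    \<open>t\<close> to \<open>v\<close> would join \<open>u\<close> to \<open>v\<close> in 5 moves,
    below the distance 6.\<close>
  have "\<not> (legal_move G ^^ 3) s t"
  proof
    assume "(legal_move G ^^ 3) s t"
    then have "(legal_move G ^^ Suc 3) u t" using s(2) by (rule relpowp_Suc_I2[rotated])
    then have "(legal_move G ^^ Suc (Suc 3)) u v"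
      using legal_move_sym[OF t(2)] by (rule relpowp_Suc_I)
    then have "graph_dist G u v \<le> ereal (real (Suc (Suc 3)))"
      using u by (rule graph_dist_le_relpowp_legal_move)
    with uv have "(6::ereal) \<le> ereal (real (Suc (Suc 3)))" by (rule order_trans)
    then show False by simp
  qed
  with cops_win_card_dominating_set_diff_1[OF assms(2) dom s(1) t(1)]
  have "cop_number G \<le> card S - 1" unfolding cop_number_def by (intro Least_le)
  \<comment> \<open>Positivity makes the truncated \<open>card S - 1\<close> agree with the integer
    difference in the goal.\<close>
  moreover have "card S > 0"
    using s(1) dom finite_subset[of S "verts G"] by (auto simp: card_gt_0_iff dominating_set_def)
  ultimately show ?thesis using card by simp
qed

end
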